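(* Let $s$ be an odd positive integer and $k$ a positive integer. For a strict partition $\lambda=(\lambda_1,\dots,\lambda_l)$, $$T^{(s)-}_kQ_\lambda.1=\sum_{\nu\models k}2^{l(\nu)}Q_{\lambda-s\nu}.1,$$ where the sum is over compositions $\nu=(\nu_1,\dots,\nu_l)$ of $k$ into $l$ nonnegative parts and $\lambda-s\nu=(\lambda_1-s\nu_1,\lambda_2-s\nu_2,\dots,\lambda_l-s\nu_l)$.
   Context: A strict partition has distinct positive parts. A composition $\nu\models k$ is a list of nonnegative integers with sum $k$; $l(\nu)$ denotes the number of its positive parts. Let $\Gamma_{\mathbb Q}=\mathbb Q[p_1,p_3,p_5,\dots]$. Define operators $Q_m$ ($m\in\mathbb Z$) on $\Gamma_{\mathbb Q}$ by $$Q(z)=\exp\Big(\sum_{m\ge1\text{ odd}}\tfrac2m p_mz^m\Big)\exp\Big(-\sum_{m\ge1\text{ odd}}\tfrac{\partial}{\partial p_m}z^{-m}\Big)=\sum_{m\in\mathbb Z}Q_mz^m ,$$ and for an integer vector $\alpha=(\alpha_1,\dots,\alpha_l)\in\mathbb Z^l$ put $Q_\alpha.1=Q_{\alpha_1}Q_{\alpha_2}\cdots Q_{\alpha_l}.1$ (operators applied to $1\in\Gamma_{\mathbb Q}$). The operators $T^{(s)-}_m$ on $\Gamma_{\mathbb Q}$ are defined by $$\exp\Big(\sum_{m\ge1\text{ odd}}s\frac{\partial}{\partial p_{sm}}z^{-m}\Big)=\sum_{m\ge0}T^{(s)-}_mz^{-m}.$$ *)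

theory Defs
  imports Complex_Main "HOL-Library.Poly_Mapping"
begin

section \<open>The ring \<open>\<Gamma>\<close> over the rationals\<close>

text \<open>
  The ring \<open>\<rat>[p\<^sub>1, p\<^sub>3, p\<^sub>5, \<dots>]\<close>.  A monomial is a finitely supported exponent vector
  \<open>nat \<Rightarrow>\<^sub>0 nat\<close>; the variable with index \<open>i\<close> stands for \<open>p\<^bsub>2i+1\<^esub>\<close>, so that there
  are exactly the odd power sums.  For odd \<open>m\<close> the index of \<open>p\<^sub>m\<close> is \<open>m div 2\<close>.
\<close>

type_synonym gamma = "(nat \<Rightarrow>\<^sub>0 nat) \<Rightarrow>\<^sub>0 rat"

definition const :: "rat \<Rightarrow> gamma" where
  "const c = Poly_Mapping.single 0 c"

text \<open>\<open>p_gen m\<close> is \<open>p\<^sub>m\<close> and \<open>dp m\<close> is \<open>\<partial>/\<partial>p\<^sub>m\<close>; both are only meaningful for odd \<open>m\<close>.\<close>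

definition p_gen :: "nat \<Rightarrow> gamma" where
  "p_gen m = Poly_Mapping.single (Poly_Mapping.single (m div 2) 1) 1"

definition dp :: "nat \<Rightarrow> gamma \<Rightarrow> gamma" where
  "dp m f = (\<Sum>\<mu>\<in>Poly_Mapping.keys f.
     Poly_Mapping.single (\<mu> - Poly_Mapping.single (m div 2) 1)
       (of_nat (Poly_Mapping.lookup \<mu> (m div 2)) * Poly_Mapping.lookup f \<mu>))"

lemma lookup_dp:
  "Poly_Mapping.lookup (dp m f) \<mu> = of_nat (Poly_Mapping.lookup \<mu> (m div 2) + 1) *
     Poly_Mapping.lookup f (\<mu> + Poly_Mapping.single (m div 2) 1)"
proof -
  define i where "i = m div 2"
  define e :: "nat \<Rightarrow>\<^sub>0 nat" where "e = Poly_Mapping.single i 1"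
  let ?g = "\<lambda>\<nu>. of_nat (Poly_Mapping.lookup \<nu> i) * Poly_Mapping.lookup f \<nu>"
  have *: "\<nu> = \<mu> + e" if "\<nu> - e = \<mu>" "Poly_Mapping.lookup \<nu> i \<noteq> 0" for \<nu>
    unfolding that(1)[symmetric] using that(2)
    by (intro poly_mapping_eqI) (auto simp: e_def lookup_add lookup_minus lookup_single when_def)
  have "Poly_Mapping.lookup (dp m f) \<mu> = (\<Sum>\<nu>\<in>Poly_Mapping.keys f. ?g \<nu> when \<nu> - e = \<mu>)"
    by (simp add: dp_def lookup_sum lookup_single i_def e_def)
  also have "\<dots> = (\<Sum>\<nu>\<in>Poly_Mapping.keys f. if \<nu> = \<mu> + e then ?g (\<mu> + e) else 0)"
    using * by (intro sum.cong refl) (auto simp: when_def)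
  also have "\<dots> = ?g (\<mu> + e)"
    by (auto simp: sum.delta in_keys_iff)
  finally show ?thesis by (simp add: i_def e_def lookup_add lookup_single)
qed


section \<open>Formal power series of operators\<close>

text \<open>
  \<open>A :: opseries\<close> represents \<open>\<Sum>n. A n w\<^sup>n\<close> with operators \<open>A n\<close> on \<open>\<Gamma>\<close> as coefficients.
  The product of two coefficients is their composition.
\<close>

type_synonym opseries = "nat \<Rightarrow> gamma \<Rightarrow> gamma"

definition opseries_one :: opseries where
  "opseries_one n f = (if n = 0 then f else 0)"

definition opseries_mult :: "opseries \<Rightarrow> opseries \<Rightarrow> opseries" where
  "opseries_mult A B n f = (\<Sum>i\<le>n. A i (B (n - i) f))"

primrec opseries_power :: "opseries \<Rightarrow> nat \<Rightarrow> opseries" where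
  "opseries_power A 0 = opseries_one"
| "opseries_power A (Suc k) = opseries_mult A (opseries_power A k)"

text \<open>
  \<open>exp A = \<Sum>k. A\<^sup>k / k!\<close> for a series \<open>A\<close> of linear operators with \<open>A 0 = 0\<close>; then \<open>A\<^sup>k\<close> has
  no terms of order below \<open>k\<close>, so the summands with \<open>k > n\<close> do not contribute to the
  coefficient of \<open>w\<^sup>n\<close>.
\<close>

definition opseries_exp :: "opseries \<Rightarrow> opseries" where
  "opseries_exp A n f = (\<Sum>k\<le>n. const (1 / fact k) * opseries_power A k n f)"


lemma opseries_power_eq_0:
  assumes "\<And>g. A 0 g = 0" and "\<And>n. A n 0 = 0" and "n < k"
  shows "opseries_power A k n f = 0"
  using assms(3)
proof (induction k arbitrary: n)
  case 0
  then show ?case by simp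
next
  case (Suc k)
  have "A i (opseries_power A k (n - i) f) = 0" if "i \<le> n" for i
  proof (cases "i = 0")
    case False
    then have "n - i < k" using that Suc.prems by linarith
    then show ?thesis using Suc.IH assms(2) by simp
  qed (simp add: assms(1))
  then show ?case by (simp add: opseries_mult_def)
qed


section \<open>The operators\<close>

text \<open>Creation part, a series in \<open>z\<close>; annihilation part, a series in \<open>z\<^sup>-\<^sup>1\<close>.\<close>

definition creation_exponent :: opseries where
  "creation_exponent m f = (if odd m then const (2 / of_nat m) * p_gen m * f else 0)"

definition annihilation_exponent :: opseries where
  "annihilation_exponent m f = (if odd m then - dp m f else 0)"

text \<open>
  The coefficient of \<open>z\<^sup>m\<close> collects \<open>z\<^sup>i * z\<^sup>-\<^sup>j\<close> with \<open>i = m + j\<close>.  The sum over \<open>j\<close> is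
  finite when applied to a polynomial \<open>f\<close>, see \<open>finite_annihilation\<close> below; this is what
  makes \<open>Sum_any\<close> the right sum (it is \<open>0\<close> by convention for infinite supports).
\<close>

definition Q_op :: "int \<Rightarrow> gamma \<Rightarrow> gamma" where
  "Q_op m f = Sum_any (\<lambda>j :: nat. if m + int j \<ge> 0
     then opseries_exp creation_exponent (nat (m + int j)) (opseries_exp annihilation_exponent j f)
     else 0)"

text \<open>Finiteness of the sum in \<open>Q_op\<close>, by the grading with \<open>p\<^sub>m\<close> in degree \<open>m\<close>.\<close>

definition weight :: "(nat \<Rightarrow>\<^sub>0 nat) \<Rightarrow> nat" where
  "weight \<mu> = Sum_any (\<lambda>i. (2 * i + 1) * Poly_Mapping.lookup \<mu> i)"

lemma weight_add: "weight (\<mu> + \<nu>) = weight \<mu> + weight \<nu>"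
  unfolding weight_def lookup_add distrib_left
  by (rule Sum_any.distrib) (auto intro: finite_mult_not_eq_zero_leftI)

lemma weight_single: "weight (Poly_Mapping.single i 1) = 2 * i + 1"
  by (simp add: weight_def lookup_single when_def if_distrib[of "\<lambda>x. _ * x"] cong: if_cong)

definition weight_le :: "int \<Rightarrow> gamma \<Rightarrow> bool" where
  "weight_le d f \<longleftrightarrow> (\<forall>\<mu>\<in>Poly_Mapping.keys f. int (weight \<mu>) \<le> d)"

lemma weight_le_0 [simp]: "weight_le d 0"
  by (simp add: weight_le_def)

lemma weight_le_neg_iff: "d < 0 \<Longrightarrow> weight_le d f \<longleftrightarrow> f = 0"
  by (metis (no_types, lifting) ex_in_conv keys_eq_empty le_less_trans not_less of_nat_0_le_iff
      weight_le_0 weight_le_def)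

lemma weight_le_sum:
  assumes "\<And>i. i \<in> I \<Longrightarrow> weight_le d (g i)"
  shows "weight_le d (sum g I)"
  using assms
proof (induction I rule: infinite_finite_induct)
  case (insert x F)
  then show ?case
    using keys_add[of "g x" "sum g F"] by (auto simp: weight_le_def)
qed simp_all

lemma weight_le_const_mult: "weight_le d f \<Longrightarrow> weight_le d (const c * f)"
  using keys_mult[of "const c" f] by (fastforce simp: weight_le_def const_def split: if_splits)

lemma weight_le_dp:
  assumes "weight_le d f" and "odd m"
  shows "weight_le (d - int m) (dp m f)"
  unfolding dp_def
proof (rule weight_le_sum)
  fix \<mu> assume \<mu>: "\<mu> \<in> Poly_Mapping.keys f"
  define i where "i = m div 2"
  have m: "m = 2 * i + 1" using assms(2) by (simp add: i_def)
  show "weight_le (d - int m) (Poly_Mapping.single (\<mu> - Poly_Mapping.single (m div 2) 1)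
          (of_nat (Poly_Mapping.lookup \<mu> (m div 2)) * Poly_Mapping.lookup f \<mu>))"
  proof (cases "Poly_Mapping.lookup \<mu> i = 0")
    case False
    have "\<mu> = (\<mu> - Poly_Mapping.single i 1) + Poly_Mapping.single i 1"
      using False by (intro poly_mapping_eqI) (auto simp: lookup_add lookup_minus lookup_single when_def)
    then have "weight \<mu> = weight (\<mu> - Poly_Mapping.single i 1) + m"
      by (metis m weight_add weight_single)
    moreover have "int (weight \<mu>) \<le> d" using assms(1) \<mu> by (simp add: weight_le_def)
    ultimately show ?thesis by (simp add: weight_le_def i_def)
  qed (simp add: i_def)
qed

lemma weight_le_annihilation_power:
  assumes "weight_le d f"
  shows "weight_le (d - int n) (opseries_power annihilation_exponent k n f)"
proof (induction k arbitrary: n)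
  case 0
  show ?case using assms by (simp add: opseries_one_def)
next
  case (Suc k)
  have "weight_le (d - int n)
      (annihilation_exponent i (opseries_power annihilation_exponent k (n - i) f))" if "i \<le> n" for i
  proof (cases "odd i")
    case True
    let ?g = "opseries_power annihilation_exponent k (n - i) f"
    have "weight_le (d - int n) (dp i ?g)"
      using weight_le_dp[OF Suc.IH[of "n - i"] True] that by (simp add: of_nat_diff)
    moreover have "annihilation_exponent i ?g = - dp i ?g"
      using True by (simp only: annihilation_exponent_def if_True not_False_eq_True)
    ultimately show ?thesis by (simp add: weight_le_def)
  qed (simp add: annihilation_exponent_def)
  then show ?case by (auto simp: opseries_mult_def intro: weight_le_sum)
qed

lemma finite_annihilation: "finite {j. opseries_exp annihilation_exponent j f \<noteq> 0}"
proof -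
  define d where "d = Max (weight ` Poly_Mapping.keys f)"
  have d: "weight_le (int d) f"
    by (simp add: weight_le_def d_def)
  have "opseries_exp annihilation_exponent j f = 0" if "d < j" for j
  proof -
    have "weight_le (int d - int j) (opseries_exp annihilation_exponent j f)"
      unfolding opseries_exp_def
      by (intro weight_le_sum weight_le_const_mult weight_le_annihilation_power d)
    then show ?thesis using that by (simp add: weight_le_neg_iff)
  qed
  then have "{j. opseries_exp annihilation_exponent j f \<noteq> 0} \<subseteq> {..d}"
    by (auto simp: not_less[symmetric])
  then show ?thesis by (rule finite_subset) simp
qed

definition Q_one :: "int list \<Rightarrow> gamma" where
  "Q_one \<alpha> = foldr Q_op \<alpha> 1"

text \<open>
  \<open>T_minus s m\<close> is the operator \<open>T\<close> with superscript \<open>(s)-\<close> and subscript \<open>m\<close>, the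
  coefficient of \<open>z\<^bsup>-m\<^esup>\<close>.  It is only meaningful for odd \<open>s\<close>.
\<close>

definition T_exponent :: "nat \<Rightarrow> opseries" where
  "T_exponent s m f = (if odd m then of_nat s * dp (s * m) f else 0)"

definition T_minus :: "nat \<Rightarrow> nat \<Rightarrow> gamma \<Rightarrow> gamma" where
  "T_minus s m = opseries_exp (T_exponent s) m"


section \<open>Partitions and compositions\<close>

definition strict_partition :: "nat list \<Rightarrow> bool" where
  "strict_partition l \<longleftrightarrow> sorted_wrt (>) l \<and> (\<forall>x\<in>set l. x > 0)"

definition compositions :: "nat \<Rightarrow> nat \<Rightarrow> nat list set" where
  "compositions k l = {\<nu>. length \<nu> = l \<and> sum_list \<nu> = k}"

lemma finite_compositions: "finite (compositions k l)"
proof -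
  have "compositions k l \<subseteq> {\<nu>. set \<nu> \<subseteq> {..k} \<and> length \<nu> = l}"
    by (auto simp: compositions_def intro: member_le_sum_list)
  then show ?thesis by (rule finite_subset) (simp add: finite_lists_length_eq)
qed

text \<open>The number \<open>l(\<nu>)\<close> of positive parts.\<close>

definition positive_parts :: "nat list \<Rightarrow> nat" where
  "positive_parts \<nu> = length (filter (\<lambda>x. x > 0) \<nu>)"

text \<open>\<open>\<lambda> - s \<nu>\<close>, an integer vector whose entries may be negative.\<close>

definition minus_scaled :: "nat list \<Rightarrow> nat \<Rightarrow> nat list \<Rightarrow> int list" where
  "minus_scaled l s \<nu> = map2 (\<lambda>a b. int a - int s * int b) l \<nu>"

end

theory Submission
  imports Defs
begin

text \<open>
  Write \<open>T(w) = \<Sum>k. T\<^sub>k w\<^sup>-\<^sup>k\<close> for the series of the operators \<open>T_minus s k\<close>.  Its exponent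
  is a derivation, so \<open>T(w)\<close> is the substitution \<open>p\<^bsub>si\<^esub> \<mapsto> p\<^bsub>si\<^esub> + s w\<^sup>-\<^sup>i\<close> for odd \<open>i\<close>.  It commutes
  with the annihilation part of \<open>Q(z)\<close>, and it multiplies the creation part by
  \<open>exp (\<Sum>i odd. (2 / i) (z\<^sup>s / w)\<^sup>i) = (1 + z\<^sup>s / w) / (1 - z\<^sup>s / w) = 1 + 2 \<Sum>j\<ge>1. (z\<^sup>s / w)\<^sup>j\<close>.
  With \<open>c\<^sub>0 = 1\<close> and \<open>c\<^sub>j = 2\<close> for \<open>j \<ge> 1\<close> this says
  \<open>T\<^sub>k Q\<^sub>m = \<Sum>j\<le>k. c\<^sub>j Q\<^bsub>m - sj\<^esub> T\<^bsub>k - j\<^esub>\<close>, which is \<open>T_minus_Q_op\<close>.  Moving \<open>T\<^sub>k\<close> to the right through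
  \<open>Q\<^bsub>\<lambda>\<^sub>1\<^esub> Q\<^bsub>\<lambda>\<^sub>2\<^esub> \<dots>\<close> in this way distributes \<open>k\<close> over the factors as a composition \<open>\<nu>\<close>, with one
  factor \<open>2\<close> for every positive part; at the end \<open>T\<^sub>k\<close> meets \<open>1\<close> and annihilates it unless \<open>k = 0\<close>.

  To avoid manipulating double series of exponentials, the commutation relation is proved
  infinitesimally.  If \<open>\<delta>\<close> is a derivation on series of operators and \<open>\<delta> A\<close> commutes with \<open>A\<close>, then
  \<open>\<delta> (exp A) = \<delta> A exp A\<close> (\<open>derivation_opseries_exp\<close>).  For \<open>\<delta> = [X, _]\<close>, with \<open>X\<close> a coefficient
  \<open>X\<^sub>i = s \<partial>/\<partial>p\<^bsub>si\<^esub>\<close> of the exponent of \<open>T\<close>, it gives \<open>[X\<^sub>i, Q\<^sub>m] = (2 / i) Q\<^bsub>m - si\<^esub>\<close>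
  (\<open>T_exponent_Q_op\<close>).  For the Euler derivation, which multiplies the coefficient
  of order \<open>k\<close> by \<open>k\<close>, it gives the recurrence \<open>k T\<^sub>k = \<Sum>i\<le>k. i X\<^sub>i T\<^bsub>k - i\<^esub>\<close>
  (\<open>T_minus_recurrence\<close>).  Together they determine the commutation relation by induction on \<open>k\<close>.
\<close>

section \<open>Additive operators on the ring of odd power sums\<close>

lemma const_0 [simp]: "const 0 = 0"
  by (simp add: const_def)

lemma const_1 [simp]: "const 1 = 1"
  by (simp add: const_def)

lemma const_mult: "const (a * b) = const a * const b"
  by (simp add: const_def mult_single)

lemma const_of_nat [simp]: "const (of_nat n) = of_nat n"
  by (simp add: const_def)

lemma const_of_int [simp]: "const (of_int n) = of_int n"
  by (simp add: const_def)

lemma of_nat_mult_left_cancel: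
  fixes x y :: gamma
  assumes "of_nat n * x = of_nat n * y" and "n \<noteq> 0"
  shows "x = y"
proof -
  have unit: "const (1 / of_nat n) * of_nat n = 1"
    using assms(2) by (simp flip: const_of_nat const_mult)
  have "const (1 / of_nat n) * (of_nat n * x) = const (1 / of_nat n) * (of_nat n * y)"
    by (simp only: assms(1))
  then show ?thesis
    by (simp add: unit flip: mult.assoc)
qed

lemma additive_of_nat_mult:
  fixes F :: "gamma \<Rightarrow> gamma"
  assumes "additive F"
  shows "F (of_nat n * x) = of_nat n * F x"
  by (induction n) (simp_all add: additive.zero[OF assms] additive.add[OF assms] distrib_right)

text \<open>
  An additive map between vector spaces over the rationals is automatically linear.  Additivity is
  therefore the only property of the operators that has to be recorded, and all scalars can be
  pulled out of them by this lemma.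
\<close>
lemma additive_const_mult:
  fixes F :: "gamma \<Rightarrow> gamma"
  assumes "additive F"
  shows "F (const c * x) = const c * F x"
proof -
  interpret additive F by fact
  have int: "F (of_int n * y) = of_int n * F y" for n y
    by (cases n rule: int_diff_cases)
       (simp add: left_diff_distrib diff additive_of_nat_mult[OF assms])
  obtain a b where ab: "c = of_int a / of_int b" "b > 0"
    by (metis Fract_of_int_quotient Rat_cases)
  define n where "n = nat b"
  have n: "n \<noteq> 0" "of_nat n = (of_int b :: gamma)"
    using ab(2) by (simp_all add: n_def)
  have "of_nat n * const c = of_int a"
    using ab n by (simp flip: const_of_int const_mult)
  then have "of_nat n * F (const c * x) = of_nat n * (const c * F x)"
    by (simp add: int flip: additive_of_nat_mult[OF assms] mult.assoc)
  then show ?thesis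
    using of_nat_mult_left_cancel n(1) by blast
qed

lemma additive_mult: "additive (\<lambda>f. q * f)" for q :: gamma
  by unfold_locales (rule distrib_left)

lemma additive_eqI:
  fixes F G :: "gamma \<Rightarrow> gamma"
  assumes "additive F" and "additive G"
    and "\<And>\<mu> c. F (Poly_Mapping.single \<mu> c) = G (Poly_Mapping.single \<mu> c)"
  shows "F f = G f"
proof -
  have "f = (\<Sum>\<mu>\<in>Poly_Mapping.keys f. Poly_Mapping.single \<mu> (Poly_Mapping.lookup f \<mu>))"
    by (rule poly_mapping_eqI) (auto simp: lookup_sum lookup_single when_def in_keys_iff)
  then show ?thesis
    by (metis (no_types, lifting) additive.sum assms sum.cong)
qed


section \<open>Partial derivatives\<close>

lemma additive_dp: "additive (dp m)"
  by unfold_locales (rule poly_mapping_eqI, simp add: lookup_dp lookup_add distrib_left)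

lemma dp_single:
  "dp m (Poly_Mapping.single \<mu> c) = Poly_Mapping.single (\<mu> - Poly_Mapping.single (m div 2) 1)
     (of_nat (Poly_Mapping.lookup \<mu> (m div 2)) * c)"
  by (simp add: dp_def)

lemma dp_one: "dp m 1 = 0"
  by (simp add: dp_single flip: single_one)

lemma dp_commute: "dp m (dp n f) = dp n (dp m f)"
  by (rule poly_mapping_eqI) (auto simp: lookup_dp lookup_add lookup_single when_def add_ac)

text \<open>
  The Leibniz rule for multiplication by a generator: for odd indices, the Heisenberg relation
  that \<open>[\<partial>/\<partial>p\<^sub>m, p\<^sub>n]\<close> is \<open>1\<close> if \<open>m = n\<close> and \<open>0\<close> otherwise.  Both sides are additive in \<open>f\<close>, so monomials suffice.
\<close>
lemma dp_p_gen_mult: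
  "dp m (p_gen n * f) = (if m div 2 = n div 2 then f else 0) + p_gen n * dp m f"
proof (rule additive_eqI[where F = "\<lambda>f. dp m (p_gen n * f)"])
  show "additive (\<lambda>f. dp m (p_gen n * f))"
    by unfold_locales (simp add: distrib_left additive.add[OF additive_dp])
  show "additive (\<lambda>f. (if m div 2 = n div 2 then f else 0) + p_gen n * dp m f)"
    by unfold_locales (simp add: distrib_left additive.add[OF additive_dp])
  fix \<mu> :: "nat \<Rightarrow>\<^sub>0 nat" and c :: rat
  define i j where "i = m div 2" and "j = n div 2"
  let ?e = "\<lambda>i. Poly_Mapping.single i (1 :: nat)"
  \<comment> \<open>Subtraction of exponents is truncated, so it may be reassociated only where the variable
    with index \<open>i\<close> occurs in \<open>\<mu>\<close>; elsewhere the coefficient produced by the derivative is \<open>0\<close>.\<close>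
  have shift: "?e j + \<mu> - ?e i = ?e j + (\<mu> - ?e i)" if "Poly_Mapping.lookup \<mu> i > 0"
    using that by (intro poly_mapping_eqI) (auto simp: lookup_add lookup_minus lookup_single when_def)
  show "dp m (p_gen n * Poly_Mapping.single \<mu> c) =
      (if m div 2 = n div 2 then Poly_Mapping.single \<mu> c else 0) + p_gen n * dp m (Poly_Mapping.single \<mu> c)"
    using shift
    by (cases "Poly_Mapping.lookup \<mu> i = 0")
       (auto simp: p_gen_def dp_single mult_single lookup_add lookup_single i_def[symmetric] j_def[symmetric]
          distrib_right single_add)
qed


section \<open>Derivations of series of operators\<close>

lemma sum_triangle_swap:
  "(\<Sum>i\<le>n. \<Sum>j\<le>n - i. g i j) = (\<Sum>j\<le>n. \<Sum>i\<le>n - j. g i j)"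
  for n :: nat
  by (simp add: sum.Sigma)
     (rule sum.reindex_bij_witness[where i = "\<lambda>(x, y). (y, x)" and j = "\<lambda>(x, y). (y, x)"], auto)

lemma sum_triangle_diagonal:
  "(\<Sum>i\<le>n. \<Sum>j\<le>n - i. g i j) = (\<Sum>r\<le>n. \<Sum>i\<le>r. g i (r - i))"
  for n :: nat
  by (simp add: sum.Sigma)
     (rule sum.reindex_bij_witness[where i = "\<lambda>(r, i). (i, r - i)" and j = "\<lambda>(i, j). (i + j, i)"], auto)

lemma opseries_mult_one_right:
  assumes "\<And>i. additive (A i)"
  shows "opseries_mult A opseries_one n f = A n f"
proof -
  have "opseries_mult A opseries_one n f = (\<Sum>i\<le>n. if i = n then A n f else 0)"
    unfolding opseries_mult_def opseries_one_def
    by (intro sum.cong) (auto simp: additive.zero[OF assms])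
  then show ?thesis by simp
qed

lemma opseries_mult_left_commute:
  assumes "\<And>i. additive (A i)" and "\<And>i. additive (B i)"
    and "\<And>i j f. A i (B j f) = B j (A i f)"
  shows "opseries_mult A (opseries_mult B M) n f = opseries_mult B (opseries_mult A M) n f"
proof -
  have "opseries_mult A (opseries_mult B M) n f = (\<Sum>i\<le>n. \<Sum>j\<le>n - i. B j (A i (M (n - i - j) f)))"
    by (simp add: opseries_mult_def additive.sum[OF assms(1)] assms(3))
  also have "\<dots> = (\<Sum>j\<le>n. \<Sum>i\<le>n - j. B j (A i (M (n - i - j) f)))"
    by (rule sum_triangle_swap)
  also have "\<dots> = opseries_mult B (opseries_mult A M) n f"
    by (simp add: opseries_mult_def additive.sum[OF assms(2)] add.commute)
  finally show ?thesis .
qed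

text \<open>
  The power rule \<open>\<delta> (A\<^bsup>k+1\<^esup>) = (k + 1) B A\<^sup>k\<close> for \<open>B = \<delta> A\<close>.  In a noncommutative ring it needs that
  \<open>B\<close> can be moved to the front past the powers of \<open>A\<close>.  The Leibniz rule is asked for only when
  the left factor is \<open>A\<close>, which is all that the induction meets.
\<close>
lemma derivation_opseries_power:
  fixes A B :: opseries and \<delta> :: "opseries \<Rightarrow> opseries"
  assumes A: "\<And>i. additive (A i)" and B: "\<And>i. additive (B i)"
    and commute: "\<And>i j f. A i (B j f) = B j (A i f)"
    and one: "\<And>n f. \<delta> opseries_one n f = 0"
    and leibniz: "\<And>M n f. \<delta> (opseries_mult A M) n f =
                   opseries_mult B M n f + opseries_mult A (\<delta> M) n f"
  shows "\<delta> (opseries_power A (Suc k)) n f = of_nat (Suc k) * opseries_mult B (opseries_power A k) n f"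
proof (induction k arbitrary: n f)
  case 0
  show ?case
    using leibniz[of opseries_one]
    by (simp add: opseries_mult_def[of A "\<delta> _"] one additive.zero[OF A])
next
  case (Suc k)
  let ?P = "opseries_power A"
  have "\<delta> (?P (Suc (Suc k))) n f =
      opseries_mult B (?P (Suc k)) n f + opseries_mult A (\<delta> (?P (Suc k))) n f"
    by (simp add: leibniz)
  also have "opseries_mult A (\<delta> (?P (Suc k))) n f =
      of_nat (Suc k) * opseries_mult A (opseries_mult B (?P k)) n f"
    unfolding opseries_mult_def[of A] Suc.IH
    by (simp only: additive_of_nat_mult[OF A] sum_distrib_left)
  also have "opseries_mult A (opseries_mult B (?P k)) n f = opseries_mult B (?P (Suc k)) n f"
    by (simp add: opseries_mult_left_commute[OF A B commute])
  also have "opseries_mult B (?P (Suc k)) n f + of_nat (Suc k) * opseries_mult B (?P (Suc k)) n f =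
      of_nat (Suc (Suc k)) * opseries_mult B (?P (Suc k)) n f"
    by (simp only: of_nat_Suc[of "Suc k"] distrib_right mult_1_left)
  finally show ?case .
qed

text \<open>
  The power rule summed over \<open>k\<close> with weights \<open>1 / k!\<close>.  The definition of the exponential cuts the
  coefficient of order \<open>n\<close> off at \<open>k = n\<close>; the last hypothesis says that \<open>\<delta>\<close> may be applied under
  this sum.
\<close>
lemma derivation_opseries_exp:
  fixes A B :: opseries and \<delta> :: "opseries \<Rightarrow> opseries"
  assumes A: "\<And>i. additive (A i)" and B: "\<And>i. additive (B i)"
    and A0: "\<And>f. A 0 f = 0" and B0: "\<And>f. B 0 f = 0"
    and commute: "\<And>i j f. A i (B j f) = B j (A i f)"
    and one: "\<And>n f. \<delta> opseries_one n f = 0"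
    and leibniz: "\<And>M n f. \<delta> (opseries_mult A M) n f =
                   opseries_mult B M n f + opseries_mult A (\<delta> M) n f"
    and linear: "\<And>n f. \<delta> (opseries_exp A) n f =
                   (\<Sum>k\<le>n. const (1 / fact k) * \<delta> (opseries_power A k) n f)"
  shows "\<delta> (opseries_exp A) n f = opseries_mult B (opseries_exp A) n f"
proof -
  let ?P = "opseries_power A"
  have "\<delta> (opseries_exp A) n f = (\<Sum>k<n. const (1 / fact (Suc k)) * \<delta> (?P (Suc k)) n f)"
    unfolding linear by (subst sum.atMost_shift) (simp add: one)
  also have "\<dots> = (\<Sum>k<n. const (1 / fact k) * opseries_mult B (?P k) n f)"
  proof (rule sum.cong[OF refl])
    fix k
    have "1 / fact (Suc k) * of_nat (Suc k) = (1 / fact k :: rat)"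
      by (simp add: field_simps del: of_nat_Suc)
    then have "const (1 / fact (Suc k)) * of_nat (Suc k) = const (1 / fact k)"
      by (simp only: flip: const_of_nat const_mult)
    then show "const (1 / fact (Suc k)) * \<delta> (?P (Suc k)) n f = const (1 / fact k) * opseries_mult B (?P k) n f"
      by (simp only: derivation_opseries_power[where \<delta> = \<delta>, OF A B commute one leibniz] flip: mult.assoc)
  qed
  also have "\<dots> = (\<Sum>i\<le>n. B i (\<Sum>k<n. const (1 / fact k) * ?P k (n - i) f))"
    unfolding opseries_mult_def sum_distrib_left additive.sum[OF B] additive_const_mult[OF B]
    by (rule sum.swap)
  also have "\<dots> = opseries_mult B (opseries_exp A) n f"
    unfolding opseries_mult_def
  proof (rule sum.cong[OF refl])
    fix i assume "i \<in> {..n}"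
    show "B i (\<Sum>k<n. const (1 / fact k) * ?P k (n - i) f) = B i (opseries_exp A (n - i) f)"
    proof (cases "i = 0")
      case False
      \<comment> \<open>Since \<open>B\<close> starts in order one, the sum runs past the cutoff \<open>n - i\<close> of the exponential,
        and powers beyond the cutoff do not contribute.\<close>
      have "(\<Sum>k<n. const (1 / fact k) * ?P k (n - i) f) = opseries_exp A (n - i) f"
        unfolding opseries_exp_def using False \<open>i \<in> {..n}\<close>
        by (intro sum.mono_neutral_right)
           (auto simp: opseries_power_eq_0 A0 additive.zero[OF A])
      then show ?thesis by simp
    qed (simp add: B0)
  qed
  finally show ?thesis .
qed

lemma opseries_exp_0: "opseries_exp A 0 f = f"
  by (simp add: opseries_exp_def opseries_one_def)

lemma additive_opseries_exp:
  assumes "\<And>i. additive (A i)"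
  shows "additive (opseries_exp A n)"
proof -
  have "opseries_power A k n (f + g) = opseries_power A k n f + opseries_power A k n g" for k n f g
    by (induction k arbitrary: n)
       (simp_all add: opseries_one_def opseries_mult_def additive.add[OF assms] sum.distrib)
  then show ?thesis
    by unfold_locales (simp add: opseries_exp_def distrib_left sum.distrib)
qed

text \<open>
  Logarithmic differentiation: for \<open>E = exp A\<close> this is \<open>w E' = (w A') E\<close>, from the
  Euler derivation that multiplies the coefficient of order \<open>n\<close> by \<open>n\<close>.
\<close>
lemma opseries_exp_recurrence:
  assumes A: "\<And>i. additive (A i)" and A0: "\<And>f. A 0 f = 0"
    and commute: "\<And>i j f. A i (A j f) = A j (A i f)"
  shows "of_nat n * opseries_exp A n f = (\<Sum>i\<le>n. of_nat i * A i (opseries_exp A (n - i) f))"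
proof -
  define B :: opseries where "B = (\<lambda>i f. of_nat i * A i f)"
  define \<delta> :: "opseries \<Rightarrow> opseries" where "\<delta> = (\<lambda>M n f. of_nat n * M n f)"
  have "\<delta> (opseries_exp A) n f = opseries_mult B (opseries_exp A) n f"
  proof (rule derivation_opseries_exp[OF A])
    show "additive (B i)" for i
      by unfold_locales (simp add: B_def additive.add[OF A] distrib_left)
    show "A i (B j f) = B j (A i f)" for i j f
      by (simp add: B_def additive_of_nat_mult[OF A] commute)
    show "\<delta> (opseries_mult A M) n f = opseries_mult B M n f + opseries_mult A (\<delta> M) n f" for M n f
    proof -
      have step: "of_nat n * A i (M (n - i) f) = B i (M (n - i) f) + A i (\<delta> M (n - i) f)" if le: "i \<le> n" for i
      proof -
        obtain l where "n = i + l"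
          using le_Suc_ex[OF le] by blast
        show ?thesis unfolding \<open>n = i + l\<close>
          by (simp add: B_def \<delta>_def additive_of_nat_mult[OF A] distrib_right)
      qed
      have "\<delta> (opseries_mult A M) n f = (\<Sum>i\<le>n. of_nat n * A i (M (n - i) f))"
        by (simp add: \<delta>_def opseries_mult_def sum_distrib_left)
      also have "\<dots> = opseries_mult B M n f + opseries_mult A (\<delta> M) n f"
        unfolding opseries_mult_def sum.distrib[symmetric]
        by (intro sum.cong) (simp_all add: step)
      finally show ?thesis .
    qed
  qed (simp_all add: A0 B_def \<delta>_def opseries_one_def opseries_exp_def sum_distrib_left mult.left_commute)
  then show ?thesis
    by (simp add: B_def \<delta>_def opseries_mult_def)
qed

text \<open>
  The infinitesimal form of \<open>e\<^sup>X e\<^sup>A = e\<^bsup>[X, A]\<^esup> e\<^sup>A e\<^sup>X\<close> for a central commutator, from the inner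
  derivation \<open>\<delta> M = [X, M]\<close>.  A scalar commutator commutes with \<open>A\<close> because additive operators
  are linear over the rationals.
\<close>
lemma commutator_opseries_exp:
  assumes X: "additive X" and A: "\<And>i. additive (A i)" and A0: "\<And>f. A 0 f = 0"
    and commutator: "\<And>i f. X (A i f) = A i (X f) + const (b i) * f"
  shows "X (opseries_exp A n f) = opseries_exp A n (X f) + (\<Sum>i\<le>n. const (b i) * opseries_exp A (n - i) f)"
proof -
  define B :: opseries where "B = (\<lambda>i f. const (b i) * f)"
  define \<delta> :: "opseries \<Rightarrow> opseries" where "\<delta> = (\<lambda>M n f. X (M n f) - M n (X f))"
  have "\<delta> (opseries_exp A) n f = opseries_mult B (opseries_exp A) n f"
  proof (rule derivation_opseries_exp[OF A])
    show "additive (B i)" for i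
      by (simp add: B_def additive_mult)
    show "B 0 f = 0" for f
      using commutator[of 0] by (simp add: B_def A0 additive.zero[OF X])
    show "A i (B j f) = B j (A i f)" for i j f
      by (simp add: B_def additive_const_mult[OF A])
    show "\<delta> opseries_one n f = 0" for n f
      by (simp add: \<delta>_def opseries_one_def additive.zero[OF X])
    show "\<delta> (opseries_mult A M) n f = opseries_mult B M n f + opseries_mult A (\<delta> M) n f" for M n f
      by (simp add: \<delta>_def opseries_mult_def B_def additive.sum[OF X] additive.diff[OF A] commutator
          sum.distrib sum_subtractf)
    show "\<delta> (opseries_exp A) n f = (\<Sum>k\<le>n. const (1 / fact k) * \<delta> (opseries_power A k) n f)" for n f
      by (simp add: \<delta>_def opseries_exp_def additive.sum[OF X] additive_const_mult[OF X]
          right_diff_distrib sum_subtractf)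
  qed (rule A0)
  then show ?thesis
    by (simp add: B_def \<delta>_def opseries_mult_def algebra_simps)
qed


section \<open>The vertex operators\<close>

lemma additive_T_exponent: "additive (T_exponent s i)"
  by unfold_locales (simp add: T_exponent_def additive.add[OF additive_dp] distrib_left)

lemma additive_creation_exponent: "additive (creation_exponent i)"
  by unfold_locales (simp add: creation_exponent_def distrib_left)

lemma additive_annihilation_exponent: "additive (annihilation_exponent i)"
  by unfold_locales (simp add: annihilation_exponent_def additive.add[OF additive_dp])

lemmas additive_creation = additive_opseries_exp[OF additive_creation_exponent]
  and additive_annihilation = additive_opseries_exp[OF additive_annihilation_exponent]
  and additive_T_minus = additive_opseries_exp[OF additive_T_exponent, folded T_minus_def]

lemma T_exponent_commute: "T_exponent s i (T_exponent s j f) = T_exponent s j (T_exponent s i f)"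
  by (simp add: T_exponent_def additive_of_nat_mult[OF additive_dp] additive.zero[OF additive_dp]
      dp_commute[of "s * i"])

text \<open>
  The factors \<open>s\<close> of \<open>s \<partial>/\<partial>p\<^bsub>si\<^esub>\<close> and \<open>2 / (si)\<close> of the creation exponent combine to \<open>2 / i\<close>.
\<close>
lemma T_exponent_creation_exponent:
  assumes "odd s" and "odd i"
  shows "T_exponent s i (creation_exponent n f) =
    creation_exponent n (T_exponent s i f) + const (if n = s * i then 2 / of_nat i else 0) * f"
proof (cases "odd n")
  case True
  \<comment> \<open>The variable of odd index \<open>m\<close> is encoded by \<open>m div 2\<close>, which is injective on odd numbers
    only; this is where the parity of \<open>s\<close> enters.\<close>
  have n: "s * i div 2 = n div 2 \<longleftrightarrow> n = s * i"
  proof -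
    have "odd (s * i)"
      using assms by simp
    with True show ?thesis
      by presburger
  qed
  have pos: "s > 0" "i > 0"
    using assms by (auto intro: Nat.gr0I)
  have "T_exponent s i (creation_exponent n f) =
      of_nat s * (const (2 / of_nat n) * ((if n = s * i then f else 0) + p_gen n * dp (s * i) f))"
    using True assms
    by (simp add: T_exponent_def creation_exponent_def mult.assoc additive_const_mult[OF additive_dp]
        dp_p_gen_mult n)
  also have "\<dots> = of_nat s * const (2 / of_nat n) * (if n = s * i then f else 0) +
      creation_exponent n (T_exponent s i f)"
    using True assms by (simp add: T_exponent_def creation_exponent_def algebra_simps)
  also have "of_nat s * const (2 / of_nat n) * (if n = s * i then f else 0) =
      const (if n = s * i then 2 / of_nat i else 0) * f"
    using pos by (simp add: field_simps flip: const_of_nat const_mult)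
  finally show ?thesis by (simp add: add.commute)
next
  case False
  then show ?thesis
    using assms by (auto simp: creation_exponent_def additive.zero[OF additive_T_exponent])
qed

lemma T_exponent_creation:
  assumes "odd s" and "odd i"
  shows "T_exponent s i (opseries_exp creation_exponent n f) =
    opseries_exp creation_exponent n (T_exponent s i f) +
    (if s * i \<le> n then const (2 / of_nat i) * opseries_exp creation_exponent (n - s * i) f else 0)"
proof -
  let ?C = "opseries_exp creation_exponent"
  have "(\<Sum>l\<le>n. const (if l = s * i then 2 / of_nat i else 0) * ?C (n - l) f) =
      (\<Sum>l\<le>n. if l = s * i then const (2 / of_nat i) * ?C (n - s * i) f else 0)"
    by (intro sum.cong) auto
  then show ?thesis
    by (subst commutator_opseries_exp[OF additive_T_exponent additive_creation_exponent _
          T_exponent_creation_exponent[OF assms]])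
       (simp_all add: creation_exponent_def)
qed

text \<open>
  Both operators are built from partial derivatives, so the commutator has scalar part \<open>0\<close>.
\<close>
lemma T_exponent_annihilation:
  "T_exponent s i (opseries_exp annihilation_exponent n f) =
    opseries_exp annihilation_exponent n (T_exponent s i f)"
proof -
  have "T_exponent s i (annihilation_exponent j f) = annihilation_exponent j (T_exponent s i f) + const 0 * f"
    for j f
    by (simp add: T_exponent_def annihilation_exponent_def additive.minus[OF additive_dp]
        additive_of_nat_mult[OF additive_dp] additive.zero[OF additive_dp] dp_commute[of "s * i"])
  from commutator_opseries_exp[where A = annihilation_exponent and b = "\<lambda>_. 0", OF additive_T_exponent additive_annihilation_exponent _ this]
  show ?thesis by (simp add: annihilation_exponent_def)
qed

text \<open>
  \<open>Q_op\<close> sums over a support that depends on \<open>f\<close>.  To compare its values at several arguments, the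
  sums have to run over one common finite index set.
\<close>
lemma Q_op_eq_sum:
  assumes "finite J" and "{j. opseries_exp annihilation_exponent j f \<noteq> 0} \<subseteq> J"
  shows "Q_op m f = (\<Sum>j\<in>J. if m + int j \<ge> 0
     then opseries_exp creation_exponent (nat (m + int j)) (opseries_exp annihilation_exponent j f)
     else 0)"
  unfolding Q_op_def using assms
  by (intro Sum_any.expand_superset) (auto simp: additive.zero[OF additive_creation])

lemma additive_Q_op: "additive (Q_op m)"
proof
  fix f g
  let ?supp = "\<lambda>f. {j. opseries_exp annihilation_exponent j f \<noteq> 0}"
  define J where "J = ?supp f \<union> ?supp g"
  have J: "finite J" "?supp f \<subseteq> J" "?supp g \<subseteq> J" "?supp (f + g) \<subseteq> J"
    by (auto simp: J_def finite_annihilation additive.add[OF additive_annihilation])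
  show "Q_op m (f + g) = Q_op m f + Q_op m g"
    unfolding J(2-4)[THEN Q_op_eq_sum[OF J(1)]] sum.distrib[symmetric]
    by (intro sum.cong)
       (simp_all add: additive.add[OF additive_annihilation] additive.add[OF additive_creation])
qed

text \<open>
  The generating function of this identity is \<open>[X\<^sub>i, Q(z)] = (2 / i) z\<^bsup>si\<^esup> Q(z)\<close>: only the creation
  part of \<open>Q(z)\<close> contributes, and lowering its order by \<open>si\<close> lowers \<open>m\<close> by \<open>si\<close> for every order
  \<open>j\<close> of the annihilation part.
\<close>
lemma T_exponent_Q_op:
  assumes "odd s" and "odd i"
  shows "T_exponent s i (Q_op m f) =
    Q_op m (T_exponent s i f) + const (2 / of_nat i) * Q_op (m - int (s * i)) f"
proof -
  let ?C = "opseries_exp creation_exponent" and ?D = "opseries_exp annihilation_exponent"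
  let ?X = "T_exponent s i"
  define J where "J = {j. ?D j f \<noteq> 0}"
  \<comment> \<open>The support for \<open>?X f\<close> is contained in that for \<open>f\<close>, because \<open>?X\<close> commutes with \<open>?D j\<close>.\<close>
  have J: "finite J" "{j. ?D j f \<noteq> 0} \<subseteq> J" "{j. ?D j (?X f) \<noteq> 0} \<subseteq> J"
    by (auto simp: J_def finite_annihilation additive.zero[OF additive_T_exponent]
        simp flip: T_exponent_annihilation)
  have nat_diff: "nat (m - int (s * i) + int j) = nat (m + int j) - s * i" for j
    by linarith
  have "?X (Q_op m f) = (\<Sum>j\<in>J. ?X (if m + int j \<ge> 0 then ?C (nat (m + int j)) (?D j f) else 0))"
    by (simp only: Q_op_eq_sum[OF J(1,2)] additive.sum[OF additive_T_exponent])
  also have "\<dots> = (\<Sum>j\<in>J. (if m + int j \<ge> 0 then ?C (nat (m + int j)) (?D j (?X f)) else 0) +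
      const (2 / of_nat i) *
      (if m - int (s * i) + int j \<ge> 0 then ?C (nat (m - int (s * i) + int j)) (?D j f) else 0))"
  proof (rule sum.cong[OF refl])
    fix j
    show "?X (if m + int j \<ge> 0 then ?C (nat (m + int j)) (?D j f) else 0) =
      (if m + int j \<ge> 0 then ?C (nat (m + int j)) (?D j (?X f)) else 0) +
      const (2 / of_nat i) *
      (if m - int (s * i) + int j \<ge> 0 then ?C (nat (m - int (s * i) + int j)) (?D j f) else 0)"
    proof (cases "m + int j \<ge> 0")
      case True
      then have "m - int (s * i) + int j \<ge> 0 \<longleftrightarrow> s * i \<le> nat (m + int j)"
        by linarith
      with True show ?thesis
        by (simp only: nat_diff T_exponent_creation[OF assms] T_exponent_annihilation if_True
            if_distrib[of "\<lambda>x. _ * x"] mult_zero_right)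
    next
      case False
      then have "\<not> m - int (s * i) + int j \<ge> 0"
        by linarith
      with False show ?thesis
        by (simp only: if_False additive.zero[OF additive_T_exponent] mult_zero_right add_0_right)
    qed
  qed
  also have "\<dots> = Q_op m (?X f) + const (2 / of_nat i) * Q_op (m - int (s * i)) f"
    by (simp only: Q_op_eq_sum[OF J(1,2)] Q_op_eq_sum[OF J(1,3)] sum.distrib sum_distrib_left)
  finally show ?thesis .
qed


section \<open>Commuting the operators past each other\<close>

text \<open>
  The coefficients of \<open>K(u) = (1 + u) / (1 - u)\<close>, the factor that \<open>T(w)\<close> picks up from \<open>Q(z)\<close> at
  \<open>u = z\<^sup>s / w\<close>.
\<close>
definition kernel_coeff :: "nat \<Rightarrow> gamma" where
  "kernel_coeff j = (if j = 0 then 1 else 2)"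

text \<open>
  The coefficients of \<open>u K'(u) / K(u) = 2u / (1 - u\<^sup>2)\<close>.
\<close>
definition log_kernel_coeff :: "nat \<Rightarrow> gamma" where
  "log_kernel_coeff i = (if odd i then 2 else 0)"

text \<open>
  The coefficient form of \<open>u K' = (u K' / K) K\<close>, proved by counting the odd numbers up to \<open>r\<close>.
\<close>
lemma kernel_coeff_recurrence:
  "(\<Sum>i\<le>r. log_kernel_coeff i * kernel_coeff (r - i)) = of_nat r * kernel_coeff r"
proof (cases r)
  case (Suc q)
  \<comment> \<open>Apart from \<open>i = r\<close>, every odd \<open>i\<close> contributes \<open>2 * 2\<close>.\<close>
  have count: "(\<Sum>i\<le>q. log_kernel_coeff i) = of_nat (if odd q then Suc q else q)"
    by (induction q) (auto simp: log_kernel_coeff_def)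
  have "(\<Sum>i\<le>q. log_kernel_coeff i * kernel_coeff (r - i)) = 2 * (\<Sum>i\<le>q. log_kernel_coeff i)"
    unfolding sum_distrib_left
    by (intro sum.cong) (auto simp: Suc kernel_coeff_def mult.commute)
  then show ?thesis
    by (simp add: Suc count) (simp add: log_kernel_coeff_def kernel_coeff_def algebra_simps)
qed (simp add: log_kernel_coeff_def)

lemma additive_kernel_coeff_mult:
  assumes "additive F"
  shows "F (kernel_coeff j * f) = kernel_coeff j * F f"
  using additive_of_nat_mult[OF assms, of 2 f] by (simp add: kernel_coeff_def)

text \<open>
  The commutator scaled by \<open>i\<close>, in the form in which it occurs in the recurrence for \<open>T_minus\<close>.
  The scaling makes it valid for all \<open>i\<close>, with both sides trivial for even \<open>i\<close>.
\<close>
lemma scaled_T_exponent_Q_op: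
  assumes "odd s"
  shows "of_nat i * T_exponent s i (Q_op m f) =
    Q_op m (of_nat i * T_exponent s i f) + log_kernel_coeff i * Q_op (m - int s * int i) f"
proof (cases "odd i")
  case True
  have two: "const 2 = 2"
    using const_of_nat[of 2] by simp
  have "of_nat i * const (2 / of_nat i) = const 2"
    using True by (auto simp flip: const_of_nat const_mult elim: oddE)
  then have "of_nat i * const (2 / of_nat i) = 2"
    by (simp only: two)
  then show ?thesis
    using True
    by (simp add: T_exponent_Q_op[OF assms] additive_of_nat_mult[OF additive_Q_op] log_kernel_coeff_def
        distrib_left flip: mult.assoc)
next
  case False
  then show ?thesis
    by (simp add: T_exponent_def log_kernel_coeff_def additive.zero[OF additive_Q_op])
qed

lemma T_minus_recurrence:
  "of_nat k * T_minus s k f = (\<Sum>i\<le>k. of_nat i * T_exponent s i (T_minus s (k - i) f))"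
  unfolding T_minus_def
  by (rule opseries_exp_recurrence[OF additive_T_exponent _ T_exponent_commute])
     (simp add: T_exponent_def)

lemma T_minus_one: "T_minus s k 1 = (if k = 0 then 1 else 0)"
proof (induction k rule: less_induct)
  case (less k)
  show ?case
  proof (cases "k = 0")
    case False
    have vanish: "of_nat i * T_exponent s i (T_minus s (k - i) 1) = 0" for i
    proof (cases "i = 0")
      case False
      then show ?thesis
        using less[of "k - i"] \<open>k \<noteq> 0\<close>
        by (simp add: T_exponent_def dp_one additive.zero[OF additive_dp])
    qed simp
    have "of_nat k * T_minus s k 1 = of_nat k * 0"
      by (simp only: T_minus_recurrence vanish sum.neutral_const mult_zero_right)
    then show ?thesis
      using False of_nat_mult_left_cancel by auto
  qed (simp add: T_minus_def opseries_exp_0)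
qed

text \<open>
  The coefficient form of \<open>T(w) Q(z) = K(z\<^sup>s / w) Q(z) T(w)\<close>.  Multiply by \<open>k\<close>, expand \<open>k T\<^sub>k\<close> by its
  recurrence, use the induction hypothesis for the \<open>T\<^bsub>k - i\<^esub>\<close>, and move \<open>i X\<^sub>i\<close> past the \<open>Q\<close> operators.
  In the term with index \<open>j\<close>, passing \<open>Q\<close> reassembles \<open>(k - j) T\<^bsub>k - j\<^esub>\<close> by the same recurrence,
  and the commutators sum up to \<open>j c\<^sub>j\<close> by the recurrence for the kernel.  The two multiples add up
  to \<open>k\<close>, which cancels.
\<close>
lemma T_minus_Q_op:
  assumes "odd s"
  shows "T_minus s k (Q_op m f) =
    (\<Sum>j\<le>k. kernel_coeff j * Q_op (m - int s * int j) (T_minus s (k - j) f))"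
proof (induction k rule: less_induct)
  case (less k)
  let ?Y = "\<lambda>i f. of_nat i * T_exponent s i f" and ?T = "T_minus s"
  let ?Q = "\<lambda>j. Q_op (m - int s * int j)"
  have Y: "additive (?Y i)" for i
    by unfold_locales (simp add: additive.add[OF additive_T_exponent] distrib_left)
  have YQ: "?Y i (?Q j g) = ?Q j (?Y i g) + log_kernel_coeff i * ?Q (i + j) g" for i j g
    using scaled_T_exponent_Q_op[OF assms, of i "m - int s * int j" g]
    by (simp add: algebra_simps)
  have YcQ: "?Y i (kernel_coeff j * ?Q j (?T (k - i - j) f)) =
      kernel_coeff j * ?Q j (?Y i (?T (k - j - i) f)) +
      log_kernel_coeff i * kernel_coeff j * ?Q (i + j) (?T (k - (i + j)) f)" for i j
  proof -
    have diff: "k - i - j = k - (i + j)" "k - j - i = k - (i + j)"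
      by simp_all
    show ?thesis
      unfolding diff additive_kernel_coeff_mult[OF Y] YQ
      by (simp only: distrib_left mult.assoc mult.left_commute[of "log_kernel_coeff i"])
  qed
  have "of_nat k * ?T k (Q_op m f) = (\<Sum>i\<le>k. ?Y i (?T (k - i) (Q_op m f)))"
    by (rule T_minus_recurrence)
  also have "\<dots> = (\<Sum>i\<le>k. ?Y i (\<Sum>j\<le>k - i. kernel_coeff j * ?Q j (?T (k - i - j) f)))"
  proof (rule sum.cong[OF refl])
    fix i assume "i \<in> {..k}"
    then show "?Y i (?T (k - i) (Q_op m f)) = ?Y i (\<Sum>j\<le>k - i. kernel_coeff j * ?Q j (?T (k - i - j) f))"
      \<comment> \<open>For \<open>i = 0\<close> the induction hypothesis is not available, but both sides have the factor \<open>0\<close>.\<close>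
      by (cases "i = 0") (simp_all add: less)
  qed
  also have "\<dots> = (\<Sum>i\<le>k. \<Sum>j\<le>k - i. kernel_coeff j * ?Q j (?Y i (?T (k - j - i) f))) +
      (\<Sum>i\<le>k. \<Sum>j\<le>k - i. log_kernel_coeff i * kernel_coeff j * ?Q (i + j) (?T (k - (i + j)) f))"
    by (simp only: additive.sum[OF Y] YcQ sum.distrib)
  also have "(\<Sum>i\<le>k. \<Sum>j\<le>k - i. kernel_coeff j * ?Q j (?Y i (?T (k - j - i) f))) =
      (\<Sum>j\<le>k. \<Sum>i\<le>k - j. kernel_coeff j * ?Q j (?Y i (?T (k - j - i) f)))"
    by (rule sum_triangle_swap)
  also have "\<dots> = (\<Sum>j\<le>k. kernel_coeff j * ?Q j (of_nat (k - j) * ?T (k - j) f))"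
    by (simp only: T_minus_recurrence additive.sum[OF additive_Q_op] sum_distrib_left)
  also have "\<dots> = (\<Sum>j\<le>k. of_nat (k - j) * (kernel_coeff j * ?Q j (?T (k - j) f)))"
    by (simp only: additive_of_nat_mult[OF additive_Q_op] mult.left_commute)
  also have "(\<Sum>i\<le>k. \<Sum>j\<le>k - i. log_kernel_coeff i * kernel_coeff j * ?Q (i + j) (?T (k - (i + j)) f)) =
      (\<Sum>r\<le>k. \<Sum>i\<le>r. log_kernel_coeff i * kernel_coeff (r - i) *
        ?Q (i + (r - i)) (?T (k - (i + (r - i))) f))"
    by (rule sum_triangle_diagonal)
  also have "\<dots> = (\<Sum>r\<le>k. of_nat r * kernel_coeff r * ?Q r (?T (k - r) f))"
    unfolding kernel_coeff_recurrence[symmetric] sum_distrib_right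
    by (intro sum.cong refl) (simp only: atMost_iff le_add_diff_inverse)
  also have "(\<Sum>j\<le>k. of_nat (k - j) * (kernel_coeff j * ?Q j (?T (k - j) f))) +
      (\<Sum>r\<le>k. of_nat r * kernel_coeff r * ?Q r (?T (k - r) f)) =
      (\<Sum>j\<le>k. of_nat k * (kernel_coeff j * ?Q j (?T (k - j) f)))"
    unfolding sum.distrib[symmetric]
    by (intro sum.cong refl) (simp only: mult.assoc atMost_iff le_add_diff_inverse2
        flip: distrib_right of_nat_add)
  also have "\<dots> = of_nat k * (\<Sum>j\<le>k. kernel_coeff j * ?Q j (?T (k - j) f))"
    by (simp only: sum_distrib_left)
  finally show ?case
    using of_nat_mult_left_cancel[of k] by (cases "k = 0") (auto simp: T_minus_def opseries_exp_0 kernel_coeff_def)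
qed


section \<open>Summation over compositions\<close>

lemma compositions_0: "compositions k 0 = (if k = 0 then {[]} else {})"
  by (auto simp: compositions_def)

lemma sum_compositions_Suc:
  "(\<Sum>\<nu>\<in>compositions k (Suc l). g \<nu>) = (\<Sum>j\<le>k. \<Sum>\<nu>\<in>compositions (k - j) l. g (j # \<nu>))"
  unfolding sum.Sigma[OF finite_atMost ballI[OF finite_compositions]]
  by (rule sum.reindex_bij_witness[where j = "\<lambda>\<nu>. (hd \<nu>, tl \<nu>)" and i = "\<lambda>(j, \<nu>). j # \<nu>"])
     (auto simp: compositions_def length_Suc_conv)

text \<open>
  Induction on the vector: the part \<open>j\<close> of the composition belonging to the first entry is the
  summation index in the commutation relation, and \<open>c\<^sub>j\<close> accounts for whether \<open>j\<close> is
  positive.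
\<close>
lemma T_minus_Q_one:
  assumes "odd s"
  shows "T_minus s k (Q_one (map int lam)) =
    (\<Sum>\<nu>\<in>compositions k (length lam). 2 ^ positive_parts \<nu> * Q_one (minus_scaled lam s \<nu>))"
proof (induction lam arbitrary: k)
  case Nil
  show ?case
    by (simp add: Q_one_def T_minus_one compositions_0 minus_scaled_def positive_parts_def)
next
  case (Cons a lam)
  have pull: "Q_op m (2 ^ e * x) = 2 ^ e * Q_op m x" for m e x
    using additive_of_nat_mult[OF additive_Q_op, of m "2 ^ e" x] by simp
  have "T_minus s k (Q_one (map int (a # lam))) =
      (\<Sum>j\<le>k. kernel_coeff j * Q_op (int a - int s * int j) (T_minus s (k - j) (Q_one (map int lam))))"
    using T_minus_Q_op[OF assms, of k "int a" "Q_one (map int lam)"] by (simp add: Q_one_def)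
  also have "\<dots> = (\<Sum>j\<le>k. \<Sum>\<nu>\<in>compositions (k - j) (length lam).
      2 ^ positive_parts (j # \<nu>) * Q_one (minus_scaled (a # lam) s (j # \<nu>)))"
    by (simp add: Cons.IH additive.sum[OF additive_Q_op] pull sum_distrib_left)
       (intro sum.cong, auto simp: kernel_coeff_def positive_parts_def minus_scaled_def Q_one_def)
  finally show ?case
    by (simp add: sum_compositions_Suc)
qed

theorem theorem3p2:
  fixes s k :: nat and lam :: "nat list"
  assumes "odd s" and "k > 0" and "strict_partition lam"
  shows "T_minus s k (Q_one (map int lam)) =
    (\<Sum>\<nu>\<in>compositions k (length lam). 2 ^ positive_parts \<nu> * Q_one (minus_scaled lam s \<nu>))"
  using assms(1) by (rule T_minus_Q_one)

end
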